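(* Let $k$ be a positive integer and let $p$ be a prime number such that $p\equiv 5\pmod 6$. Let $r$ be a non-negative integer such that $p$ divides $6r+5$. Then for every integer $n\ge 0$, $$B_3\left(p^{k+1}n+pr+\frac{5p-1}{6}\right)\equiv(-p)\cdot B_3\left(p^{k-1}n+\frac{6r+5-p}{6p}\right)\pmod 3.$$
   Context: A partition is called $3$-regular if none of its parts is divisible by $3$. $B_3(n)$ denotes the number of ordered pairs $(\lambda,\mu)$ of $3$-regular partitions such that the sum of all parts of $\lambda$ and $\mu$ equals $n$ (so $B_3(0)=1$); equivalently $\sum_{n\ge 0}B_3(n)q^n=\prod_{k\ge1}\frac{(1-q^{3k})^2}{(1-q^k)^2}$. *)

theory Defs
  imports "HOL-Library.Multiset" "HOL-Number_Theory.Number_Theory"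
begin

definition is_partition :: "nat multiset \<Rightarrow> bool" where
  "is_partition M \<longleftrightarrow> (\<forall>x\<in>#M. x > 0)"

definition regular_partition :: "nat \<Rightarrow> nat multiset \<Rightarrow> bool" where
  "regular_partition l M \<longleftrightarrow> is_partition M \<and> (\<forall>x\<in>#M. \<not> l dvd x)"

definition B3 :: "nat \<Rightarrow> nat" where
  "B3 n = card {(L, M). regular_partition 3 L \<and> regular_partition 3 M \<and>
                        sum_mset L + sum_mset M = n}"

(* The cardinality in B3 is that of a finite set, so it is a genuine count. *)

lemma size_le_sum_mset_partition:
  assumes "is_partition M"
  shows "size M \<le> sum_mset M"
  using assms
proof (induction M)
  case (add x M)
  then have "size M \<le> sum_mset M" and "x \<ge> 1"
    by (auto simp: is_partition_def)
  then show ?case by simp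
qed simp

lemma member_le_sum_mset_nat:
  fixes x :: nat
  assumes "x \<in># M"
  shows "x \<le> sum_mset M"
  using sum_mset.remove[OF assms] by simp

lemma finite_partitions_le: "finite {M. is_partition M \<and> sum_mset M \<le> n}"
proof (rule finite_subset)
  show "{M. is_partition M \<and> sum_mset M \<le> n}
          \<subseteq> (\<Union>k\<in>{..n}. {M. set_mset M \<subseteq> {..n} \<and> size M = k})"
  proof
    fix M assume "M \<in> {M. is_partition M \<and> sum_mset M \<le> n}"
    then show "M \<in> (\<Union>k\<in>{..n}. {M. set_mset M \<subseteq> {..n} \<and> size M = k})"
      using size_le_sum_mset_partition[of M] by (auto dest: member_le_sum_mset_nat)
  qed
  show "finite (\<Union>k\<in>{..n}. {M. set_mset M \<subseteq> {..n} \<and> size M = k})"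
    using finite_multisets_of_size[of "{..n}"] by (simp add: multisets_of_size_def)
qed

lemma finite_B3:
  "finite {(L, M). regular_partition 3 L \<and> regular_partition 3 M \<and> sum_mset L + sum_mset M = n}"
  by (rule finite_subset[OF _ finite_cartesian_product[OF
        finite_partitions_le[of n] finite_partitions_le[of n]]])
     (auto simp: regular_partition_def)

lemma B3_0: "B3 0 = 1"
proof -
  have "M = {#}" if "regular_partition 3 M" "sum_mset M = 0" for M
    using size_le_sum_mset_partition[of M] that by (simp add: regular_partition_def)
  moreover have "regular_partition 3 {#}"
    by (simp add: regular_partition_def is_partition_def)
  ultimately have "{(L, M). regular_partition 3 L \<and> regular_partition 3 M \<and>
                      sum_mset L + sum_mset M = 0} = {({#}, {#})}"
    by auto
  then show ?thesis by (simp add: B3_def)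
qed

(* For p prime with p mod 6 = 5 and p dvd 6 * r + 5, both quotients below are exact and the
   subtractions in them do not truncate, so (natural-number) div agrees with rational division. *)

lemma first_quotient_exact:
  fixes p :: nat
  assumes "[p = 5] (mod 6)"
  shows "1 \<le> 5 * p" and "6 dvd 5 * p - 1"
proof -
  have "p = 6 * (p div 6) + 5"
    using assms mult_div_mod_eq[of 6 p] by (simp add: cong_def)
  then obtain j where j: "p = 6 * j + 5" by blast
  show "1 \<le> 5 * p" by (simp add: j)
  have "5 * p - 1 = 6 * (5 * j + 4)" by (simp add: j)
  then show "6 dvd 5 * p - 1" by (metis dvd_triv_left)
qed

lemma second_quotient_exact:
  fixes p r :: nat
  assumes "[p = 5] (mod 6)" and "p dvd 6 * r + 5"
  shows "p \<le> 6 * r + 5" and "6 * p dvd 6 * r + 5 - p"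
proof -
  from assms(2) obtain m where m: "6 * r + 5 = p * m" by (elim dvdE)
  have "[5 * m = p * m] (mod 6)" using assms(1) by (simp add: cong_mult cong_sym)
  also have "[p * m = 5 * 1] (mod 6)" unfolding m[symmetric] by (simp add: cong_def)
  finally have "[m = 1] (mod 6)"
    using cong_mult_lcancel_nat[of 5 6 m 1] by (simp add: coprime_iff_gcd_eq_1 gcd_non_0_nat)
  then have "m = 6 * (m div 6) + 1" using mult_div_mod_eq[of 6 m] by (simp add: cong_def)
  then obtain j where j: "m = 6 * j + 1" by blast
  show "p \<le> 6 * r + 5" using assms(2) by (intro dvd_imp_le) auto
  have "6 * r + 5 - p = 6 * p * j" unfolding m j by (simp add: distrib_left)
  then show "6 * p dvd 6 * r + 5 - p" by (metis dvd_triv_left)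
qed

end

theory Submission
  imports Defs "HOL-Computational_Algebra.Formal_Power_Series"
begin

text \<open>Modulo 3 one has \<open>1 - q\<^sup>3\<^sup>k \<equiv> (1 - q\<^sup>k)\<^sup>3\<close>, so the generating function of \<open>B\<^sub>3\<close> is congruent to
  \<open>\<Prod>(1 - q\<^sup>k)\<^sup>4\<close> and hence to \<open>\<Prod>(1 - q\<^sup>k)(1 - q\<^sup>3\<^sup>k)\<close>. By Euler's pentagonal number theorem its
  coefficient at \<open>n\<close> is a signed count of the solutions of
  \<open>(6i + 1)\<^sup>2 + 3(6j + 1)\<^sup>2 = 4(6n + 1)\<close>. Since \<open>-3\<close> is not a square modulo \<open>p\<close>, every solution of
  this equation with right-hand side divisible by \<open>p\<^sup>2\<close> is \<open>-p\<close> times a solution for the right-hand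
  side divided by \<open>p\<^sup>2\<close>, with the same sign; and \<open>-p \<equiv> 1 (mod 3)\<close>.\<close>

section \<open>Euler's pentagonal number theorem\<close>

text \<open>Generalized pentagonal numbers. With this sign of \<open>j\<close>,
  \<open>24 * pent j + 1\<close> is the square of \<open>6 * j + 1\<close>.\<close>

definition pent :: "int \<Rightarrow> nat" where
  "pent j = nat (j * (3 * j + 1) div 2)"

lemma two_pent: "2 * int (pent j) = j * (3 * j + 1)"
proof -
  have "j * (3 * j + 1) \<ge> 0"
    by (cases "j \<ge> 0") (auto intro: mult_nonpos_nonpos)
  moreover have "even (j * (3 * j + 1))" by auto
  ultimately show ?thesis by (auto simp: pent_def)
qed

lemma abs_le_pent: "\<bar>j\<bar> \<le> int (pent j)"
proof -
  have "\<bar>j\<bar> \<le> j * j"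
    using self_le_power[of "\<bar>j\<bar>" 2] by (cases "j = 0") (auto simp: power2_eq_square)
  moreover have "2 * int (pent j) = 3 * (j * j) + j"
    using two_pent[of j] by (simp add: algebra_simps)
  ultimately show ?thesis by linarith
qed

text \<open>The right-hand sides are the exponents left over in Shanks' sum when \<open>n\<close>
  grows by one.\<close>

lemma pent_Suc:
  "pent (int n + 1) = Suc n * n + Suc n * (n + 2) div 2 + Suc n"
  "pent (- int n - 1) = Suc n * n + Suc n * (n + 2) div 2"
proof -
  define t where "t = Suc n * (n + 2) div 2"
  have "2 * t = Suc n * (n + 2)" by (simp add: t_def)
  from arg_cong[OF this, of int] have t: "2 * int t = (int n + 1) * (int n + 2)"
    by (simp add: algebra_simps)
  have "2 * int (pent (int n + 1)) = 2 * int (Suc n * n + t + Suc n)"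
    unfolding two_pent of_nat_add distrib_left t by (simp add: algebra_simps)
  then show "pent (int n + 1) = Suc n * n + Suc n * (n + 2) div 2 + Suc n"
    unfolding t_def[symmetric] by (simp only: of_nat_eq_iff mult_cancel_left) simp
  have "2 * int (pent (- int n - 1)) = 2 * int (Suc n * n + t)"
    unfolding two_pent of_nat_add distrib_left t by (simp add: algebra_simps)
  then show "pent (- int n - 1) = Suc n * n + Suc n * (n + 2) div 2"
    unfolding t_def[symmetric] by (simp only: of_nat_eq_iff mult_cancel_left) simp
qed

definition pent_sum :: "nat \<Rightarrow> 'a :: comm_ring_1 \<Rightarrow> 'a" where
  "pent_sum n q = (\<Sum>j\<in>{-int n..int n}. (-1) ^ nat \<bar>j\<bar> * q ^ pent j)"

lemma pent_sum_Suc: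
  "pent_sum (Suc n) q = pent_sum n q +
     (-1) ^ Suc n * (q ^ pent (int n + 1) + q ^ pent (- int n - 1))"
proof -
  have "{-int (Suc n)..int (Suc n)} = insert (int n + 1) (insert (- int n - 1) {-int n..int n})"
    by auto
  moreover have "nat \<bar>int n + 1\<bar> = Suc n" "nat \<bar>- int n - 1\<bar> = Suc n" by auto
  ultimately show ?thesis
    unfolding pent_sum_def by (simp del: power_Suc add: algebra_simps)
qed

definition shanks_term :: "nat \<Rightarrow> nat \<Rightarrow> 'a :: comm_ring_1 \<Rightarrow> 'a" where
  "shanks_term n s q = (-1) ^ s * (\<Prod>k\<in>{s<..n}. 1 - q ^ k) * q ^ (s * n + s * (s + 1) div 2)"

text \<open>Passing from \<open>n\<close> to \<open>n + 1\<close>, the terms of Shanks' sum change by the differences of the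
  sequence \<open>A\<close> below, so that the change of the sum telescopes.\<close>
lemma shanks_identity:
  fixes q :: "'a :: comm_ring_1"
  shows "(\<Sum>s\<le>n. shanks_term n s q) = pent_sum n q"
proof (induction n)
  case 0
  show ?case by (simp add: shanks_term_def pent_sum_def pent_def)
next
  case (Suc n)
  \<comment> \<open>The case \<open>s = 0\<close> is separate because \<open>s - 1\<close> would
    truncate; the value 0 agrees with the factor \<open>1 - q ^ s\<close> in the formula for
    \<open>A s\<close> below.\<close>
  define A where "A = (\<lambda>s. if s = 0 then 0 else
    (-1) ^ (s - 1) * (\<Prod>k\<in>{s-1<..n}. 1 - q ^ k) * q ^ (s * n + s * (s + 1) div 2))"
  have step: "shanks_term (Suc n) s q - shanks_term n s q = A s - A (Suc s)" if "s \<le> n" for s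
  proof -
    define Q where "Q = (\<Prod>k\<in>{s<..n}. 1 - q ^ k)"
    define e where "e = s * n + s * (s + 1) div 2"
    have "{s<..Suc n} = insert (Suc n) {s<..n}" using that by auto
    then have Q1: "(\<Prod>k\<in>{s<..Suc n}. 1 - q ^ k) = (1 - q ^ Suc n) * Q"
      by (simp add: Q_def)
    have tri: "Suc s * (Suc s + 1) div 2 = s * (s + 1) div 2 + Suc s"
    proof -
      have "Suc s * (Suc s + 1) = s * (s + 1) + 2 * Suc s" by (simp add: algebra_simps)
      then show ?thesis by simp
    qed
    have e1: "s * Suc n + s * (s + 1) div 2 = e + s" by (simp add: e_def)
    have e2: "Suc s * n + Suc s * (Suc s + 1) div 2 = e + s + Suc n"
      unfolding tri by (simp add: e_def)
    have AS: "A (Suc s) = (-1) ^ s * Q * q ^ (e + s + Suc n)"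
      unfolding A_def e2 by (simp add: Q_def)
    have A: "A s = - ((-1) ^ s * (1 - q ^ s) * Q * q ^ e)"
    proof (cases s)
      case (Suc t)
      have "{t<..n} = insert s {s<..n}" using that Suc by auto
      then have "(\<Prod>k\<in>{t<..n}. 1 - q ^ k) = (1 - q ^ s) * Q" by (simp add: Q_def)
      then show ?thesis unfolding A_def e_def using Suc by simp
    qed (simp add: A_def)
    show ?thesis
      unfolding shanks_term_def Q1 e1 AS A Q_def[symmetric] e_def[symmetric]
      by (simp add: algebra_simps power_add)
  qed
  have "(\<Sum>s\<le>n. shanks_term (Suc n) s q) - pent_sum n q
      = (\<Sum>s\<le>n. shanks_term (Suc n) s q - shanks_term n s q)"
    by (simp add: sum_subtractf Suc.IH)
  also have "\<dots> = (\<Sum>s\<le>n. A s - A (Suc s))" by (simp add: step)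
  also have "\<dots> = - A (Suc n)"
    unfolding sum_telescope by (simp add: A_def)
  also have "\<dots> = (-1) ^ Suc n * q ^ pent (- int n - 1)"
    by (simp add: A_def pent_Suc)
  finally have "(\<Sum>s\<le>n. shanks_term (Suc n) s q)
      = pent_sum n q + (-1) ^ Suc n * q ^ pent (- int n - 1)"
    by (simp add: algebra_simps)
  \<comment> \<open>\<open>step\<close> covers only \<open>s \<le> n\<close>; this new last summand
    supplies the other new pentagonal exponent.\<close>
  moreover have "shanks_term (Suc n) (Suc n) q = (-1) ^ Suc n * q ^ pent (int n + 1)"
    unfolding shanks_term_def pent_Suc by (simp add: algebra_simps)
  ultimately show ?case
    unfolding pent_sum_Suc by (simp add: algebra_simps)
qed

text \<open>The summand \<open>s = 0\<close> of Shanks' sum is the product itself, and for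
  \<open>s \<ge> 1\<close> the exponent \<open>s * n + s * (s + 1) div 2\<close> is at least
  \<open>n + 1\<close>.\<close>

lemma pentagonal_number_theorem:
  fixes q :: "'a :: comm_ring_1"
  shows "q ^ Suc n dvd (\<Prod>k\<in>{1..n}. 1 - q ^ k) - pent_sum n q"
proof -
  have "{..n} = insert 0 {1..n}" by auto
  then have "(\<Sum>s\<le>n. shanks_term n s q)
      = shanks_term n 0 q + (\<Sum>s\<in>{1..n}. shanks_term n s q)" by simp
  moreover have "shanks_term n 0 q = (\<Prod>k\<in>{1..n}. 1 - q ^ k)"
    by (simp add: shanks_term_def atLeastSucAtMost_greaterThanAtMost)
  ultimately have "(\<Prod>k\<in>{1..n}. 1 - q ^ k) - pent_sum n q
      = - (\<Sum>s\<in>{1..n}. shanks_term n s q)"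
    unfolding shanks_identity by (simp add: algebra_simps)
  moreover have "q ^ Suc n dvd shanks_term n s q" if s: "s \<in> {1..n}" for s
  proof -
    have "n \<le> s * n" and "1 * 2 \<le> s * (s + 1)"
      using s mult_le_mono[of 1 s 2 "s + 1"] by auto
    then have "1 \<le> s * (s + 1) div 2" by linarith
    with \<open>n \<le> s * n\<close> have "Suc n \<le> s * n + s * (s + 1) div 2" by linarith
    then show ?thesis
      unfolding shanks_term_def by (intro dvd_mult le_imp_power_dvd)
  qed
  ultimately show ?thesis by (metis (no_types, lifting) dvd_minus_iff dvd_sum)
qed

section \<open>Truncated congruences of power series\<close>

text \<open>Truncating at degree \<open>N\<close> while reducing modulo 3 lets finite products
  replace the infinite ones.\<close>

definition fcong :: "nat \<Rightarrow> int fps \<Rightarrow> int fps \<Rightarrow> bool" where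
  "fcong N F G \<longleftrightarrow> (\<forall>i\<le>N. [fps_nth F i = fps_nth G i] (mod 3))"

lemma fcong_refl [simp]: "fcong N F F"
  by (simp add: fcong_def)

lemma fcong_sym: "fcong N F G \<Longrightarrow> fcong N G F"
  by (simp add: fcong_def cong_sym)

lemma fcong_trans [trans]: "fcong N F G \<Longrightarrow> fcong N G H \<Longrightarrow> fcong N F H"
  by (auto simp: fcong_def intro: cong_trans)

lemma fcong_mult: "fcong N F G \<Longrightarrow> fcong N F' G' \<Longrightarrow> fcong N (F * F') (G * G')"
  by (auto simp: fcong_def fps_mult_nth intro!: cong_sum cong_mult)

lemma fcong_prod: "(\<And>k. k \<in> S \<Longrightarrow> fcong N (F k) (G k)) \<Longrightarrow> fcong N (prod F S) (prod G S)"
  by (induction S rule: infinite_finite_induct) (auto intro: fcong_mult)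

lemma fcong_power: "fcong N F G \<Longrightarrow> fcong N (F ^ m) (G ^ m)"
  by (induction m) (auto intro: fcong_mult)

lemma fcong_dvd_3: "3 dvd F - G \<Longrightarrow> fcong N F G"
proof -
  assume "3 dvd F - G"
  then obtain H where "F = G + 3 * H" by (metis dvdE diff_add_cancel add.commute)
  moreover have "fps_nth (3 * H) i = 3 * fps_nth H i" for i
    by (simp add: numeral_fps_const)
  ultimately show ?thesis by (simp add: fcong_def cong_iff_dvd_diff)
qed

lemma fcong_dvd_X_power: "fps_X ^ m dvd F - G \<Longrightarrow> N < m \<Longrightarrow> fcong N F G"
proof -
  assume "fps_X ^ m dvd F - G" "N < m"
  then obtain H where "F = G + fps_X ^ m * H" by (metis dvdE diff_add_cancel add.commute)
  then show ?thesis using \<open>N < m\<close> by (simp add: fcong_def fps_X_power_mult_nth)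
qed

text \<open>A power series with constant term 1 has an inverse with integer coefficients.\<close>

lemma fcong_cancel:
  assumes "fcong N (F * D) (G * D)" and "fps_nth D 0 = 1"
  shows "fcong N F G"
proof -
  obtain E where E: "D * E = 1"
    using assms(2) fps_right_inverse[of D 1] by auto
  have "fcong N (F * D * E) (G * D * E)" by (rule fcong_mult[OF assms(1) fcong_refl])
  then show ?thesis by (simp only: mult.assoc E mult_1_right)
qed

section \<open>Generating functions of partitions\<close>

definition parts_gf :: "nat set \<Rightarrow> int fps" where
  "parts_gf S = Abs_fps (\<lambda>n. int (card {M. set_mset M \<subseteq> S \<and> sum_mset M = n}))"

lemma finite_parts: "0 \<notin> S \<Longrightarrow> finite {M. set_mset M \<subseteq> S \<and> sum_mset M = (n :: nat)}"
  by (rule finite_subset[OF _ finite_partitions_le[of n]]) (auto simp: is_partition_def intro!: gr0I)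

text \<open>Removing one copy of \<open>k\<close> matches the partitions of \<open>n\<close> that
  use \<open>k\<close> with all partitions of \<open>n - k\<close>, so the factor
  \<open>1 - fps_X ^ k\<close> leaves those avoiding \<open>k\<close>.\<close>

lemma parts_gf_insert:
  assumes "0 \<notin> insert k S" and "k \<notin> S"
  shows "parts_gf (insert k S) * (1 - fps_X ^ k) = parts_gf S"
proof (rule fps_ext)
  fix n
  let ?C = "\<lambda>S n. {M. set_mset M \<subseteq> S \<and> sum_mset M = n}"
  show "fps_nth (parts_gf (insert k S) * (1 - fps_X ^ k)) n = fps_nth (parts_gf S) n"
  proof (cases "n < k")
    case True
    have "?C (insert k S) n = ?C S n"
      using True by (fastforce dest: member_le_sum_mset_nat)
    then show ?thesis using True
      by (simp add: parts_gf_def right_diff_distrib fps_X_power_mult_right_nth)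
  next
    case False
    have "?C (insert k S) n = ?C S n \<union> add_mset k ` ?C (insert k S) (n - k)"
    proof (intro equalityI subsetI)
      fix M assume M: "M \<in> ?C (insert k S) n"
      show "M \<in> ?C S n \<union> add_mset k ` ?C (insert k S) (n - k)"
      proof (cases "k \<in># M")
        case True
        then obtain M' where "M = add_mset k M'" by (meson multi_member_split)
        then show ?thesis using M by auto
      qed (use M in auto)
    qed (use False in auto)
    moreover have "?C S n \<inter> add_mset k ` ?C (insert k S) (n - k) = {}"
    proof -
      have "k \<notin># M" if "M \<in> ?C S n" for M using that assms(2) by blast
      moreover have "k \<in># M" if "M \<in> add_mset k ` ?C (insert k S) (n - k)" for M
        using that by force
      ultimately show ?thesis by blast
    qed
    moreover have "finite (?C S n)" "finite (?C (insert k S) (n - k))"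
      using assms(1) by (auto intro!: finite_parts)
    moreover have "inj_on (add_mset k) (?C (insert k S) (n - k))" by (simp add: inj_on_def)
    ultimately have "card (?C (insert k S) n) = card (?C S n) + card (?C (insert k S) (n - k))"
      by (simp only: card_Un_disjoint finite_imageI card_image)
    then show ?thesis using False
      by (simp add: parts_gf_def right_diff_distrib fps_X_power_mult_right_nth)
  qed
qed

lemma parts_gf_mult_prod:
  assumes "finite S" and "0 \<notin> S"
  shows "parts_gf S * (\<Prod>k\<in>S. 1 - fps_X ^ k) = 1"
  using assms
proof (induction S)
  case empty
  have "{M. set_mset M \<subseteq> {} \<and> sum_mset M = n} = (if n = 0 then {{#}} else {})" for n :: nat
    by auto
  then show ?case by (auto simp: parts_gf_def intro!: fps_ext)
next
  case (insert k S)
  then show ?case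
    using parts_gf_insert[of k S] by (simp add: mult.assoc[symmetric])
qed

lemma parts_gf_truncate:
  assumes "i \<le> N"
  shows "fps_nth (parts_gf S) i = fps_nth (parts_gf (S \<inter> {..N})) i"
proof -
  have "{M. set_mset M \<subseteq> S \<and> sum_mset M = i} = {M. set_mset M \<subseteq> S \<inter> {..N} \<and> sum_mset M = i}"
    using assms by (auto dest: member_le_sum_mset_nat)
  then show ?thesis by (simp add: parts_gf_def)
qed

lemma B3_eq_coeff: "int (B3 n) = fps_nth (parts_gf {k. \<not> 3 dvd k} ^ 2) n"
proof -
  let ?C = "\<lambda>n. {M. set_mset M \<subseteq> {k. \<not> 3 dvd k} \<and> sum_mset M = n}"
  have reg: "regular_partition 3 M \<longleftrightarrow> set_mset M \<subseteq> {k. \<not> 3 dvd k}" for M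
    by (auto simp: regular_partition_def is_partition_def intro!: gr0I)
  have "{(L, M). regular_partition 3 L \<and> regular_partition 3 M \<and> sum_mset L + sum_mset M = n}
      = (\<Union>i\<in>{0..n}. ?C i \<times> ?C (n - i))"
    unfolding reg by auto
  then have "B3 n = card (\<Union>i\<in>{0..n}. ?C i \<times> ?C (n - i))" by (simp add: B3_def)
  also have "\<dots> = (\<Sum>i\<in>{0..n}. card (?C i \<times> ?C (n - i)))"
    by (intro card_UN_disjoint) (auto intro!: finite_cartesian_product finite_parts)
  finally show ?thesis
    by (simp add: power2_eq_square fps_mult_nth parts_gf_def card_cartesian_product)
qed

text \<open>Writing \<open>?A\<close> for the series of one partition, \<open>?A * P\<close> is
  congruent to \<open>E\<close>, hence to \<open>T\<close> and to \<open>P ^ 3\<close>. Cancelling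
  \<open>P\<close> gives \<open>?A\<close> as \<open>P ^ 2\<close>, and its square
  \<open>P * P ^ 3\<close> as \<open>P * T\<close>.\<close>

lemma B3_gf_fcong:
  "fcong N (parts_gf {k. \<not> 3 dvd k} ^ 2)
     ((\<Prod>k\<in>{1..N}. 1 - fps_X ^ k) * (\<Prod>k\<in>{1..N}. 1 - (fps_X ^ 3) ^ k))"
proof -
  define P :: "int fps" where "P = (\<Prod>k\<in>{1..N}. 1 - fps_X ^ k)"
  define T :: "int fps" where "T = (\<Prod>k\<in>{1..N}. 1 - (fps_X ^ 3) ^ k)"
  define S where "S = {k. \<not> 3 dvd k} \<inter> {..N}"
  define D :: "int fps" where "D = (\<Prod>k\<in>S. 1 - fps_X ^ k)"
  define E :: "int fps" where "E = (\<Prod>k\<in>{k\<in>{1..N}. 3 dvd k}. 1 - fps_X ^ k)"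
  let ?A = "parts_gf {k. \<not> 3 dvd k}"
  \<comment> \<open>Parts above \<open>N\<close> do not affect the coefficients up to
    \<open>N\<close>, and the product formula needs a finite set of parts.\<close>
  have "fcong N (?A * D) (parts_gf S * D)"
    by (intro fcong_mult fcong_refl)
       (simp add: fcong_def S_def parts_gf_truncate[of _ N "{k. \<not> 3 dvd k}"])
  also have "parts_gf S * D = 1"
    unfolding D_def by (rule parts_gf_mult_prod) (simp_all add: S_def)
  finally have AD: "fcong N (?A * D) 1" .
  have "S \<subseteq> {1..N}" by (auto simp: S_def Suc_le_eq intro: gr0I)
  moreover have "{1..N} - S = {k\<in>{1..N}. 3 dvd k}" by (auto simp: S_def)
  ultimately have PDE: "P = D * E"
    unfolding P_def D_def E_def using prod.subset_diff[of S "{1..N}"] by (simp add: mult.commute)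
  \<comment> \<open>\<open>T\<close> has further factors, those with \<open>3 * k > N\<close>, but
    each of them is 1 up to degree \<open>N\<close>.\<close>
  have ET: "fcong N E T"
  proof -
    define J where "J = {k\<in>{1..N}. 3 * k \<le> N}"
    have "{k\<in>{1..N}. 3 dvd k} = (\<lambda>k. 3 * k) ` J"
      by (auto simp: J_def elim!: dvdE)
    then have E: "E = (\<Prod>k\<in>J. 1 - (fps_X ^ 3) ^ k)"
      unfolding E_def by (simp add: prod.reindex inj_on_def power_mult)
    have "J \<subseteq> {1..N}" by (auto simp: J_def)
    then have "T = E * (\<Prod>k\<in>{1..N} - J. 1 - (fps_X ^ 3) ^ k)"
      unfolding T_def E using prod.subset_diff[of J "{1..N}"] by (simp add: mult.commute)
    moreover have "fcong N (\<Prod>k\<in>{1..N} - J. 1 - (fps_X ^ 3) ^ k) (\<Prod>k\<in>{1..N} - J. 1)"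
      by (intro fcong_prod fcong_dvd_X_power[where m = "Suc N"])
         (auto simp: J_def power_mult[symmetric] simp del: power_Suc intro!: le_imp_power_dvd)
    ultimately show ?thesis
      using fcong_sym fcong_mult[OF fcong_refl[of N E]] by fastforce
  qed
  have TP: "fcong N (P ^ 3) T"
    unfolding P_def T_def prod_power_distrib
  proof (intro fcong_prod fcong_dvd_3)
    fix k
    have power_commute: "((fps_X :: int fps) ^ 3) ^ k = (fps_X ^ k) ^ 3"
      by (simp only: power_mult[symmetric] mult.commute)
    have "(1 - fps_X ^ k) ^ 3 - (1 - (fps_X ^ 3) ^ k) = 3 * ((fps_X ^ k) ^ 2 - fps_X ^ k :: int fps)"
      unfolding power_commute by (simp add: power2_eq_square power3_eq_cube algebra_simps)
    then show "3 dvd (1 - fps_X ^ k) ^ 3 - (1 - (fps_X ^ 3) ^ k :: int fps)" by simp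
  qed
  have "fcong N (?A * P) (1 * E)"
    using fcong_mult[OF AD fcong_refl[of N E]] by (simp add: PDE mult.assoc)
  also have "fcong N (1 * E) T" using ET by simp
  also have "fcong N T (P ^ 3)" by (rule fcong_sym[OF TP])
  also have "P ^ 3 = P ^ 2 * P" by (simp add: power2_eq_square power3_eq_cube)
  finally have "fcong N ?A (P ^ 2)"
  proof (rule fcong_cancel)
    have "fps_nth (\<Prod>k\<in>K. 1 - fps_X ^ k :: int fps) 0 = 1" if "0 \<notin> K" for K
      using that by (induction K rule: infinite_finite_induct) (auto simp: fps_X_power_nth)
    then show "fps_nth P 0 = 1" by (simp add: P_def)
  qed
  then have "fcong N (?A ^ 2) ((P ^ 2) ^ 2)" by (rule fcong_power)
  also have "(P ^ 2) ^ 2 = P * P ^ 3" by (simp add: power2_eq_square power3_eq_cube mult_ac)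
  also have "fcong N (P * P ^ 3) (P * T)" by (intro fcong_mult TP) simp
  finally show ?thesis by (simp add: P_def T_def)
qed

section \<open>Representations by a binary quadratic form\<close>

definition reps :: "nat \<Rightarrow> (int \<times> int) set" where
  "reps n = {(i, j). (6 * i + 1)\<^sup>2 + 3 * (6 * j + 1)\<^sup>2 = 4 * (6 * int n + 1)}"

definition rep_sum :: "nat \<Rightarrow> int" where
  "rep_sum n = (\<Sum>(i, j)\<in>reps n. if even (i + j) then 1 else -1)"

lemma mem_reps_iff: "(i, j) \<in> reps n \<longleftrightarrow> pent i + 3 * pent j = n"
proof -
  have sq: "(6 * i + 1)\<^sup>2 = 24 * int (pent i) + 1" for i
    using two_pent[of i] by (simp add: power2_eq_square algebra_simps)
  show ?thesis unfolding reps_def mem_Collect_eq prod.case sq of_nat_eq_iff[where 'a = int, symmetric] by auto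
qed

lemma B3_cong_rep_sum: "[int (B3 n) = rep_sum n] (mod 3)"
proof -
  let ?I = "{-int n..int n}"
  have 1: "fcong n (\<Prod>k\<in>{1..n}. 1 - fps_X ^ k) (pent_sum n fps_X)"
    by (rule fcong_dvd_X_power[OF pentagonal_number_theorem]) simp
  have 2: "fcong n (\<Prod>k\<in>{1..n}. 1 - (fps_X ^ 3) ^ k) (pent_sum n (fps_X ^ 3))"
    by (rule fcong_dvd_X_power[of "3 * Suc n"])
       (simp_all only: power_mult pentagonal_number_theorem, simp)
  have "fcong n (parts_gf {k. \<not> 3 dvd k} ^ 2) (pent_sum n fps_X * pent_sum n (fps_X ^ 3))"
    by (rule fcong_trans[OF B3_gf_fcong fcong_mult[OF 1 2]])
  then have "[int (B3 n) = fps_nth (pent_sum n fps_X * pent_sum n (fps_X ^ 3)) n] (mod 3)"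
    by (simp add: fcong_def B3_eq_coeff)
  also have "pent_sum n fps_X * pent_sum n (fps_X ^ 3) =
      (\<Sum>(i, j)\<in>?I \<times> ?I. fps_const (if even (i + j) then 1 else -1 :: int) * fps_X ^ (pent i + 3 * pent j))"
    unfolding pent_sum_def sum_product sum.cartesian_product
    by (intro sum.cong refl)
       (auto simp: minus_one_power_iff even_nat_iff power_add power_mult fps_const_neg[symmetric]
             simp del: fps_const_neg)
  also have "fps_nth \<dots> n = (\<Sum>(i, j)\<in>?I \<times> ?I. if (i, j) \<in> reps n then (if even (i + j) then 1 else -1) else 0)"
    unfolding fps_sum_nth by (intro sum.cong refl) (auto simp: mem_reps_iff fps_X_power_nth)
  also have "\<dots> = rep_sum n"
  proof -
    \<comment> \<open>By \<open>abs_le_pent\<close> the truncated sums already contain every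
      solution.\<close>
    have "reps n \<subseteq> ?I \<times> ?I"
    proof (clarify)
      fix i j assume "(i, j) \<in> reps n"
      then show "i \<in> ?I \<and> j \<in> ?I"
        using abs_le_pent[of i] abs_le_pent[of j] by (auto simp: mem_reps_iff)
    qed
    then show ?thesis
      unfolding rep_sum_def by (intro sum.mono_neutral_cong_right) auto
  qed
  finally show ?thesis .
qed

text \<open>Cubing is injective modulo a prime \<open>p \<equiv> 2 (mod 3)\<close>, and
  \<open>x\<^sup>2 + 3y\<^sup>2 = a\<^sup>2 + ab + b\<^sup>2\<close> divides \<open>a\<^sup>3 - b\<^sup>3\<close> for \<open>a = x - y\<close> and \<open>b = 2y\<close>.\<close>
lemma prime_dvd_sq_plus_3_sq:
  fixes x y :: int and p :: nat
  assumes p: "prime p" "[p = 5] (mod 6)" and dvd: "int p dvd x\<^sup>2 + 3 * y\<^sup>2"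
  shows "int p dvd x" and "int p dvd y"
proof -
  define a b where "a = x - y" and "b = 2 * y"
  have pp: "prime (int p)" using p by simp
  obtain m where m: "p = 3 * m + 2" and odd: "odd p"
  proof -
    have "p mod 6 = 5" using p(2) by (simp add: cong_def)
    then have "p = 3 * (2 * (p div 6) + 1) + 2" and "odd p" by presburger+
    then show ?thesis using that by blast
  qed
  have not2: "\<not> int p dvd 2"
  proof
    assume "int p dvd 2"
    then have "p dvd 2" using int_dvd_int_iff[of p 2] by simp
    then have "p \<le> 2" by (rule dvd_imp_le) simp
    with m have "p = 2" by simp
    with odd show False by simp
  qed
  have not3: "\<not> int p dvd 3"
  proof
    assume "int p dvd 3"
    then have "p dvd 3" using int_dvd_int_iff[of p 3] by simp
    then have "p \<le> 3" by (rule dvd_imp_le) simp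
    with m have "p = 2" by simp
    with odd show False by simp
  qed
  have q: "int p dvd a * a + a * b + b * b"
    using dvd by (simp add: a_def b_def power2_eq_square algebra_simps)
  have "a ^ 3 - b ^ 3 = (a - b) * (a * a + a * b + b * b)"
    by (simp add: power3_eq_cube algebra_simps)
  then have c3: "[a ^ 3 = b ^ 3] (mod int p)"
    using q by (simp add: cong_iff_dvd_diff)
  have iff: "int p dvd a \<longleftrightarrow> int p dvd b"
    using cong_dvd_iff[OF c3] pp by (simp add: prime_dvd_power_iff)
  have b: "int p dvd b"
  proof (rule ccontr)
    assume nb: "\<not> int p dvd b"
    \<comment> \<open>The exponent is \<open>p - 1\<close>. Fermat's theorem is applied to the
      natural residue \<open>d\<close> of \<open>c\<close>.\<close>
    have fermat: "[c ^ (3 * m + 1) = 1] (mod int p)" if "\<not> int p dvd c" for c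
    proof -
      have "[c ^ (p - 1) = 1] (mod int p)"
      proof -
        define d where "d = nat (c mod int p)"
        have d: "int d = c mod int p" using p(1) by (simp add: d_def prime_gt_0_nat)
        have "\<not> p dvd d"
          using that by (metis d dvd_mod_iff dvd_refl int_dvd_int_iff)
        then have "[int d ^ (p - 1) = 1] (mod int p)"
          using fermat_theorem[OF p(1)] by (metis cong_int_iff of_nat_1 of_nat_power)
        then show ?thesis unfolding d by (simp add: cong_def power_mod)
      qed
      then show ?thesis by (simp add: m)
    qed
    \<comment> \<open>Both sides are 1 modulo \<open>p\<close>; as the cubes agree, a common
      invertible factor can be cancelled to get \<open>a\<close> congruent to
      \<open>b\<close>.\<close>
    have "[a * (a ^ 3) ^ m = b * (b ^ 3) ^ m] (mod int p)"
      using cong_trans[OF fermat cong_sym[OF fermat]] iff nb by (simp add: power_mult[symmetric])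
    also have "[b * (b ^ 3) ^ m = b * (a ^ 3) ^ m] (mod int p)"
      by (intro cong_mult cong_pow cong_sym[OF c3] cong_refl)
    finally have "int p dvd (a - b) * (a ^ 3) ^ m"
      by (simp add: cong_iff_dvd_diff left_diff_distrib)
    then have "int p dvd a - b"
      using nb iff pp by (metis prime_dvd_mult_iff prime_dvd_power)
    \<comment> \<open>For \<open>a\<close> congruent to \<open>b\<close> the form reduces to
      \<open>3 * b * b\<close>, which \<open>p\<close> cannot divide.\<close>
    then obtain c where "a = b + int p * c" by (metis dvdE diff_add_cancel add.commute)
    then have "a * a + a * b + b * b = 3 * (b * b) + int p * (c * (3 * b + int p * c))"
      by (simp add: algebra_simps)
    then have "int p dvd 3 * (b * b)" using q by (simp add: dvd_add_left_iff)
    then show False using not3 nb pp by (simp add: prime_dvd_mult_iff)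
  qed
  then show "int p dvd y" using not2 pp by (auto simp: b_def prime_dvd_mult_iff)
  moreover have "int p dvd a" using b iff by simp
  ultimately show "int p dvd x" unfolding a_def by (metis dvd_add diff_add_cancel)
qed

text \<open>Multiplying \<open>6i + 1\<close> and \<open>6j + 1\<close> by \<open>-p = 1 - 6c\<close> changes the parity of both
  \<open>i\<close> and \<open>j\<close> by that of \<open>c\<close>, so it preserves the sign of each term.\<close>
lemma rep_sum_prime_sq:
  assumes p: "prime p" "[p = 5] (mod 6)" and nm: "6 * n + 1 = p\<^sup>2 * (6 * m + 1)"
  shows "rep_sum n = rep_sum m"
proof -
  define c where "c = int p div 6 + 1"
  have pc: "int p = 6 * c - 1"
  proof -
    have "int p mod 6 = 5" using p(2) by (simp add: cong_int_iff[symmetric] cong_def)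
    then show ?thesis unfolding c_def by presburger
  qed
  have nm': "6 * int n + 1 = (int p)\<^sup>2 * (6 * int m + 1)"
    using arg_cong[OF nm, of int] by (simp add: algebra_simps)
  have p0: "int p \<noteq> 0" using p(1) by auto
  \<comment> \<open>The factor is \<open>-p\<close> because \<open>-p\<close>, unlike
    \<open>p\<close>, is 1 modulo 6 and so preserves the shape \<open>6 * i + 1\<close>.\<close>
  define f where "f = (\<lambda>(i, j). (- int p * i - c, - int p * j - c))"
  have lin: "6 * (- int p * i - c) + 1 = - int p * (6 * i + 1)" for i
    using pc by (simp add: algebra_simps)
  have f_mem: "f (i, j) \<in> reps n \<longleftrightarrow> (i, j) \<in> reps m" for i j
  proof -
    have "f (i, j) \<in> reps n \<longleftrightarrow>
        (int p)\<^sup>2 * ((6 * i + 1)\<^sup>2 + 3 * (6 * j + 1)\<^sup>2) = (int p)\<^sup>2 * (4 * (6 * int m + 1))"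
      unfolding f_def reps_def mem_Collect_eq prod.case lin nm' power_mult_distrib
      by (simp add: distrib_left mult_ac)
    also have "\<dots> \<longleftrightarrow> (i, j) \<in> reps m" using p0 by (simp add: reps_def)
    finally show ?thesis .
  qed
  \<comment> \<open>The quotient \<open>x\<close> is -1 modulo 6, so \<open>-x\<close> has the form
    \<open>6 * i + 1\<close>, with \<open>i = i' - c * x\<close>.\<close>
  have preimage: "\<exists>i. i' = - int p * i - c" if "int p dvd 6 * i' + 1" for i'
  proof -
    from that obtain x where x: "6 * i' + 1 = int p * x" by (elim dvdE)
    then have "x = 6 * (c * x - i') - 1" by (simp add: pc algebra_simps)
    then have "x = - (6 * (i' - c * x) + 1)" by simp
    then have "6 * i' + 1 = 6 * (- int p * (i' - c * x) - c) + 1"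
      unfolding lin x by (metis minus_mult_commute)
    then have "i' = - int p * (i' - c * x) - c"
      by (simp only: add_right_cancel mult_cancel_left) simp
    then show ?thesis by blast
  qed
  have "f ` reps m = reps n"
  proof (intro equalityI subsetI)
    fix z assume z: "z \<in> reps n"
    obtain i' j' where z_eq: "z = (i', j')" by (cases z)
    have "(6 * i' + 1)\<^sup>2 + 3 * (6 * j' + 1)\<^sup>2 = 4 * ((int p)\<^sup>2 * (6 * int m + 1))"
      using z by (simp only: z_eq reps_def mem_Collect_eq prod.case nm')
    also have "\<dots> = int p * (int p * (4 * (6 * int m + 1)))"
      by (simp add: power2_eq_square)
    finally have "int p dvd (6 * i' + 1)\<^sup>2 + 3 * (6 * j' + 1)\<^sup>2"
      by (rule dvdI)
    note dvd = prime_dvd_sq_plus_3_sq[OF p this]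
    obtain i j where "i' = - int p * i - c" "j' = - int p * j - c"
      using preimage[OF dvd(1)] preimage[OF dvd(2)] by blast
    then have "z = f (i, j)" by (simp add: z_eq f_def)
    then show "z \<in> f ` reps m" using z f_mem by auto
  qed (use f_mem in auto)
  moreover have "inj f" using p0 by (auto simp: inj_def f_def)
  then have "inj_on f (reps m)" by (rule inj_on_subset) simp
  ultimately have "rep_sum n =
      (\<Sum>z\<in>reps m. case f z of (i, j) \<Rightarrow> if even (i + j) then 1 else -1)"
    unfolding rep_sum_def by (auto dest: sum.reindex simp: o_def)
  also have "\<dots> = rep_sum m"
    unfolding rep_sum_def
  proof (intro sum.cong refl, clarify)
    fix i j
    have "odd (int p)" using pc by simp
    then have "even (- int p * i - c + (- int p * j - c)) \<longleftrightarrow> even (i + j)" by auto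
    then show "(case f (i, j) of (i, j) \<Rightarrow> if even (i + j) then 1 else -1)
        = (if even (i + j) then 1 else (-1 :: int))"
      by (simp only: f_def prod.case)
  qed
  finally show ?thesis .
qed

theorem theorem1p6:
  fixes k p r n :: nat
  assumes "k > 0" and "prime p" and "[p = 5] (mod 6)" and "p dvd 6 * r + 5"
  shows "[int (B3 (p ^ (k + 1) * n + p * r + (5 * p - 1) div 6))
            = (- int p) * int (B3 (p ^ (k - 1) * n + (6 * r + 5 - p) div (6 * p)))] (mod 3)"
proof -
  define u where "u = (5 * p - 1) div 6"
  define v where "v = (6 * r + 5 - p) div (6 * p)"
  define N where "N = p ^ (k + 1) * n + p * r + u"
  define M where "M = p ^ (k - 1) * n + v"
  have u: "6 * u + 1 = 5 * p"
    using first_quotient_exact[OF assms(3)] by (simp add: u_def)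
  have v: "6 * p * v + p = 6 * r + 5"
    using second_quotient_exact[OF assms(3,4)] by (simp add: v_def)
  have pk: "p ^ (k + 1) = p\<^sup>2 * p ^ (k - 1)"
    using assms(1) by (simp add: power_add[symmetric])
  \<comment> \<open>One factor \<open>p\<close> comes from \<open>6 * u + 1 = 5 * p\<close>, the
    second from \<open>6 * r + 5 = p * (6 * v + 1)\<close>.\<close>
  have "6 * N + 1 = 6 * p ^ (k + 1) * n + p * (6 * r) + (6 * u + 1)"
    by (simp add: N_def algebra_simps)
  also have "\<dots> = 6 * p ^ (k + 1) * n + p * (6 * r + 5)"
    unfolding u by (simp add: algebra_simps)
  also have "\<dots> = p\<^sup>2 * (6 * M + 1)"
    unfolding v[symmetric] pk M_def by (simp add: power2_eq_square algebra_simps)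
  finally have "rep_sum N = rep_sum M" by (rule rep_sum_prime_sq[OF assms(2,3)])
  then have "[int (B3 N) = 1 * int (B3 M)] (mod 3)"
    using cong_trans[OF B3_cong_rep_sum[of N] cong_sym] B3_cong_rep_sum[of M] by simp
  also have "[1 * int (B3 M) = (- int p) * int (B3 M)] (mod 3)"
  proof (rule cong_scalar_right)
    have "int p mod 6 = 5" using assms(3) by (simp add: cong_int_iff[symmetric] cong_def)
    then have "3 dvd 1 + int p" by presburger
    then show "[1 = - int p] (mod 3)" by (simp add: cong_iff_dvd_diff)
  qed
  finally show ?thesis by (simp add: N_def M_def u_def v_def)
qed

end
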